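(* Let $G=(V,E)$ be a finite simple graph with Dirac operator $D$, Laplace–Beltrami operator $L=D^2$ and Euler characteristic $\chi(G)$. For every continuous function $f:\mathbb{R}\to\mathbb{C}$ with $f(0)=0$ one has $$\chi(G)=\mathrm{str}\big(\exp(f(D))\big),$$ where $f(D)$ is defined by the functional calculus of the symmetric matrix $D$. In particular $\mathrm{str}(\exp(-tL))=\chi(G)$ for every complex number $t$.
   Context: For a finite simple graph $G=(V,E)$ and $k\ge 0$, let $\mathcal{G}_k$ be the set of complete subgraphs of $G$ with $k+1$ vertices ($k$-simplices) and $v_k=|\mathcal{G}_k|$. Fix an orientation (an ordering of vertices up to even permutations) of each simplex. $\Omega_k$ is the real vector space of functions on oriented $k$-simplices which are antisymmetric in their $k+1$ vertex arguments; via the fixed orientations $\Omega_k\cong\mathbb{R}^{v_k}$ with the standard inner product. The exterior derivative $d_k:\Omega_k\to\Omega_{k+1}$ is $(d_kf)(x_0,\dots,x_{k+1})=\sum_{i=0}^{k+1}(-1)^i f(x_0,\dots,\hat{x}_i,\dots,x_{k+1})$. On $\Omega=\bigoplus_k\Omega_k$ (of dimension $v=\sum_k v_k$) let $d=\bigoplus_k d_k$, $d^*$ its adjoint, the Dirac operator $D=d+d^*$ and $L=D^2=dd^*+d^*d$ (a $v\times v$ matrix). The Euler characteristic is $\chi(G)=\sum_k(-1)^k v_k$. For a linear map $A$ on $\Omega$, the super trace is $\mathrm{str}(A)=\sum_k(-1)^k\mathrm{tr}(P_kAP_k|_{\Omega_k})$, where $P_k$ is the orthogonal projection onto $\Omega_k$.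 *)

theory Defs
  imports
    "HOL-Combinatorics.Permutations"
    "Jordan_Normal_Form.Spectral_Radius"
begin

section \<open>Graphs, simplices and differential forms\<close>

definition finite_simple_graph :: "'a set \<Rightarrow> 'a set set \<Rightarrow> bool" where
  "finite_simple_graph V E \<longleftrightarrow> finite V \<and> (\<forall>e\<in>E. e \<subseteq> V \<and> card e = 2)"

text \<open>A complete subgraph is identified with its vertex set.\<close>

definition simplices :: "'a set \<Rightarrow> 'a set set \<Rightarrow> nat \<Rightarrow> 'a set set" where
  "simplices V E k =
     {s. s \<subseteq> V \<and> card s = Suc k \<and> (\<forall>x\<in>s. \<forall>y\<in>s. x \<noteq> y \<longrightarrow> {x, y} \<in> E)}"

text \<open>A simplex of a graph on \<open>V\<close> has at most \<open>card V\<close> vertices, so \<open>k < card V\<close> covers all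
  dimensions.\<close>

definition euler_char :: "'a set \<Rightarrow> 'a set set \<Rightarrow> int" where
  "euler_char V E = (\<Sum>k<card V. (-1) ^ k * int (card (simplices V E k)))"

definition ordered_simplices :: "'a set \<Rightarrow> 'a set set \<Rightarrow> nat \<Rightarrow> 'a list set" where
  "ordered_simplices V E k = {xs. distinct xs \<and> set xs \<in> simplices V E k}"

text \<open>The space \<open>\<Omega>\<^sub>k\<close>. Forms are total functions on lists, normalised to vanish on every list
  that is not an ordering of a \<open>k\<close>-simplex.\<close>

definition forms :: "'a set \<Rightarrow> 'a set set \<Rightarrow> nat \<Rightarrow> ('a list \<Rightarrow> real) set" where
  "forms V E k =
     {f. (\<forall>xs. xs \<notin> ordered_simplices V E k \<longrightarrow> f xs = 0) \<and>
         (\<forall>xs\<in>ordered_simplices V E k. \<forall>p. p permutes {..<length xs} \<longrightarrow>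
            f (permute_list p xs) = of_int (sign p) * f xs)}"

definition ext_deriv ::
    "'a set \<Rightarrow> 'a set set \<Rightarrow> nat \<Rightarrow> ('a list \<Rightarrow> real) \<Rightarrow> 'a list \<Rightarrow> real" where
  "ext_deriv V E k f xs =
     (if xs \<in> ordered_simplices V E (Suc k)
      then \<Sum>i\<le>Suc k. (-1) ^ i * f (take i xs @ drop (Suc i) xs) else 0)"

section \<open>Coordinates\<close>

text \<open>A list \<open>B\<close> fixing an orientation of every simplex, namely the class of the ordering in
  which the simplex is listed, together with an enumeration of all simplices. The map
  \<open>f \<mapsto> (f (B ! i))\<^sub>i\<close> identifies the direct sum of the \<open>\<Omega>\<^sub>k\<close> with the real coordinate space of
  dimension \<open>length B\<close>.\<close>

definition oriented_enumeration :: "'a set \<Rightarrow> 'a set set \<Rightarrow> 'a list list \<Rightarrow> bool" where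
  "oriented_enumeration V E B \<longleftrightarrow>
     (\<forall>xs\<in>set B. distinct xs) \<and> distinct (map set B) \<and> set (map set B) = (\<Union>k. simplices V E k)"

text \<open>The form which is 1 on the ordering \<open>xs\<close> and vanishes on the orderings of all other
  simplices. For distinct \<open>xs\<close> the sum has at most one term.\<close>

definition unit_form :: "'a list \<Rightarrow> 'a list \<Rightarrow> real" where
  "unit_form xs ys =
     (\<Sum>p | p permutes {..<length xs} \<and> permute_list p xs = ys. of_int (sign p))"

definition ext_deriv_mat :: "'a set \<Rightarrow> 'a set set \<Rightarrow> 'a list list \<Rightarrow> real mat" where
  "ext_deriv_mat V E B =
     mat (length B) (length B)
       (\<lambda>(i, j). ext_deriv V E (length (B ! j) - 1) (unit_form (B ! j)) (B ! i))"

text \<open>The coordinates carry the standard inner product, so the adjoint is the transpose.\<close>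

definition dirac_mat :: "'a set \<Rightarrow> 'a set set \<Rightarrow> 'a list list \<Rightarrow> real mat" where
  "dirac_mat V E B = ext_deriv_mat V E B + transpose_mat (ext_deriv_mat V E B)"

definition laplace_mat :: "'a set \<Rightarrow> 'a set set \<Rightarrow> 'a list list \<Rightarrow> real mat" where
  "laplace_mat V E B = dirac_mat V E B * dirac_mat V E B"

definition mat_trace :: "'b::comm_monoid_add mat \<Rightarrow> 'b" where
  "mat_trace A = (\<Sum>i<dim_row A. A $$ (i, i))"

definition grade_proj :: "'a list list \<Rightarrow> nat \<Rightarrow> complex mat" where
  "grade_proj B k =
     mat (length B) (length B) (\<lambda>(i, j). if i = j \<and> length (B ! i) = Suc k then 1 else 0)"

definition supertrace :: "'a set \<Rightarrow> 'a list list \<Rightarrow> complex mat \<Rightarrow> complex" where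
  "supertrace V B A =
     (\<Sum>k<card V. (-1) ^ k * mat_trace (grade_proj B k * A * grade_proj B k))"

section \<open>Functional calculus and matrix exponential\<close>

definition eigenspace :: "real mat \<Rightarrow> real \<Rightarrow> real vec set" where
  "eigenspace A l = {w \<in> carrier_vec (dim_row A). A *\<^sub>v w = l \<cdot>\<^sub>v w}"

definition is_orth_proj :: "nat \<Rightarrow> real vec set \<Rightarrow> real mat \<Rightarrow> bool" where
  "is_orth_proj n W P \<longleftrightarrow>
     P \<in> carrier_mat n n \<and>
     (\<forall>x\<in>carrier_vec n. P *\<^sub>v x \<in> W \<and> (\<forall>w\<in>W. (x - P *\<^sub>v x) \<bullet> w = 0))"

definition spectral_proj :: "real mat \<Rightarrow> real \<Rightarrow> real mat" where
  "spectral_proj A l = (THE P. is_orth_proj (dim_row A) (eigenspace A l) P)"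

text \<open>For symmetric \<open>A\<close> with spectral decomposition \<open>A = (\<Sum>l. l P\<^sub>l)\<close> this is
  \<open>f(A) = (\<Sum>l. f(l) P\<^sub>l)\<close>, with \<open>P\<^sub>l\<close> the orthogonal projection onto the eigenspace of \<open>l\<close>.\<close>

definition functional_calculus :: "(real \<Rightarrow> complex) \<Rightarrow> real mat \<Rightarrow> complex mat" where
  "functional_calculus f A =
     mat (dim_row A) (dim_row A)
       (\<lambda>(i, j). \<Sum>l\<in>spectrum A. f l * complex_of_real (spectral_proj A l $$ (i, j)))"

definition mat_exp :: "complex mat \<Rightarrow> complex mat" where
  "mat_exp A =
     mat (dim_row A) (dim_row A) (\<lambda>(i, j). \<Sum>m. (A ^\<^sub>m m) $$ (i, j) / fact m)"

section \<open>Consistency of the coordinates\<close>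

lemma finite_simplices_Union:
  assumes "finite V" shows "finite (\<Union>k. simplices V E k)"
  by (rule finite_subset[of _ "Pow V"]) (use assms in \<open>auto simp: simplices_def\<close>)

lemma oriented_enumeration_exists:
  assumes "finite_simple_graph V E"
  shows "\<exists>B. oriented_enumeration V E B"
proof -
  let ?S = "\<Union>k. simplices V E k"
  have V: "finite V" using assms by (simp add: finite_simple_graph_def)
  obtain ss where ss: "set ss = ?S" "distinct ss"
    using finite_distinct_list[OF finite_simplices_Union[OF V]] by blast
  have "\<forall>s\<in>?S. \<exists>xs. set xs = s \<and> distinct xs"
    using V by (auto simp: simplices_def intro!: finite_distinct_list intro: finite_subset)
  then obtain ori where ori: "\<And>s. s \<in> ?S \<Longrightarrow> set (ori s) = s \<and> distinct (ori s)"
    by metis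
  have "map set (map ori ss) = ss"
    using ori unfolding map_map by (intro map_idI) (simp add: ss(1))
  then have "oriented_enumeration V E (map ori ss)"
    unfolding oriented_enumeration_def using ori ss by auto
  then show ?thesis by blast
qed

lemma permute_list_eq_iff:
  assumes "distinct xs" "p permutes {..<length xs}" "q permutes {..<length xs}"
  shows "permute_list p xs = permute_list q xs \<longleftrightarrow> p = q"
proof
  assume eq: "permute_list p xs = permute_list q xs"
  show "p = q"
  proof
    fix i
    show "p i = q i"
    proof (cases "i < length xs")
      case True
      then have "xs ! p i = xs ! q i"
        using arg_cong[OF eq, of "\<lambda>l. l ! i"] by (simp add: permute_list_def)
      moreover have "p i < length xs" "q i < length xs"
        using True assms permutes_in_image by (metis lessThan_iff)+
      ultimately show ?thesis using assms(1) by (simp add: nth_eq_iff_index_eq)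
    next
      case False
      then show ?thesis using assms(2,3) by (simp add: permutes_def)
    qed
  qed
qed simp

lemma unit_form_permute:
  assumes "distinct xs" "p permutes {..<length xs}"
  shows "unit_form xs (permute_list p xs) = of_int (sign p)"
proof -
  have "{q. q permutes {..<length xs} \<and> permute_list q xs = permute_list p xs} = {p}"
    using permute_list_eq_iff[OF assms(1)] assms(2) by blast
  then show ?thesis by (simp add: unit_form_def)
qed

lemma unit_form_other:
  assumes "distinct xs" "distinct ys" "set xs \<noteq> set ys"
  shows "unit_form xs ys = 0"
proof -
  have "{q. q permutes {..<length xs} \<and> permute_list q xs = ys} = {}"
    using assms(3) set_permute_list by fastforce
  then show ?thesis by (simp only: unit_form_def sum.empty)
qed

lemma ex_permute_list:
  assumes "distinct xs" "distinct ys" "set xs = set ys"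
  obtains p where "p permutes {..<length xs}" "permute_list p xs = ys"
proof -
  have "mset ys = mset xs" using assms by (simp add: set_eq_iff_mset_eq_distinct)
  then show thesis using mset_eq_permutation that by metis
qed

lemma form_expansion:
  assumes B: "oriented_enumeration V E B" and f: "f \<in> forms V E k"
    and ys: "ys \<in> ordered_simplices V E k"
  shows "f ys = (\<Sum>j<length B. f (B ! j) * unit_form (B ! j) ys)"
proof -
  have dy: "distinct ys" and "set ys \<in> set (map set B)"
    using ys B by (auto simp: ordered_simplices_def oriented_enumeration_def)
  then obtain j where j: "j < length B" "set (B ! j) = set ys"
    by (auto simp: in_set_conv_nth)
  have dB: "distinct (B ! i)" if "i < length B" for i
    using B that by (auto simp: oriented_enumeration_def)
  have other: "unit_form (B ! i) ys = 0" if "i < length B" "i \<noteq> j" for i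
  proof -
    have "set (B ! i) \<noteq> set (B ! j)"
      using B that j unfolding oriented_enumeration_def
      by (metis length_map nth_eq_iff_index_eq nth_map)
    then show ?thesis using unit_form_other dB dy that j by metis
  qed
  obtain p where p: "p permutes {..<length (B ! j)}" "permute_list p (B ! j) = ys"
    using ex_permute_list dB j dy by metis
  have "B ! j \<in> ordered_simplices V E k"
    using ys j dB by (auto simp: ordered_simplices_def)
  then have "f ys = of_int (sign p) * f (B ! j)" using f p by (auto simp: forms_def)
  also have "\<dots> = f (B ! j) * unit_form (B ! j) ys"
    using unit_form_permute[OF dB p(1)] p j by simp
  also have "\<dots> = (\<Sum>i<length B. f (B ! i) * unit_form (B ! i) ys)"
    using other j by (subst sum.remove[of _ j]) auto
  finally show ?thesis .
qed

lemma unit_form_in_forms: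
  assumes "xs \<in> ordered_simplices V E k"
  shows "unit_form xs \<in> forms V E k"
proof -
  have dx: "distinct xs" using assms by (simp add: ordered_simplices_def)
  have "unit_form xs ys = 0" if "ys \<notin> ordered_simplices V E k" for ys
  proof -
    have "{q. q permutes {..<length xs} \<and> permute_list q xs = ys} = {}"
      using that assms by (auto simp: ordered_simplices_def)
    then show ?thesis by (simp only: unit_form_def sum.empty)
  qed
  moreover have "unit_form xs (permute_list p ys) = of_int (sign p) * unit_form xs ys"
    if ys: "ys \<in> ordered_simplices V E k" and p: "p permutes {..<length ys}" for ys p
  proof (cases "set xs = set ys")
    case True
    have dy: "distinct ys" using ys by (simp add: ordered_simplices_def)
    obtain q where q: "q permutes {..<length xs}" "permute_list q xs = ys"
      using ex_permute_list[OF dx dy True] .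
    have len: "length ys = length xs" using q(2) by auto
    have "permute_list p ys = permute_list (q \<circ> p) xs"
      using q p len by (simp add: permute_list_compose flip: q(2))
    moreover have "q \<circ> p permutes {..<length xs}" using q p len by (simp add: permutes_compose)
    moreover have "sign (q \<circ> p) = sign q * sign p"
      using q p by (intro sign_compose) (auto simp: permutation_permutes)
    ultimately show ?thesis
      using unit_form_permute[OF dx] q by (metis mult.commute of_int_mult)
  next
    case False
    have "distinct ys" using ys by (simp add: ordered_simplices_def)
    then show ?thesis using False unit_form_other[OF dx] p by simp
  qed
  ultimately show ?thesis by (simp add: forms_def)
qed

lemma ext_deriv_mat_repr:
  assumes B: "oriented_enumeration V E B" and f: "f \<in> forms V E k"
  shows "ext_deriv_mat V E B *\<^sub>v vec (length B) (\<lambda>j. f (B ! j)) =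
         vec (length B) (\<lambda>i. ext_deriv V E k f (B ! i))"
proof (rule eq_vecI)
  fix i assume "i < dim_vec (vec (length B) (\<lambda>i. ext_deriv V E k f (B ! i)))"
  then have i: "i < length B" by simp
  let ?del = "\<lambda>m. take m (B ! i) @ drop (Suc m) (B ! i)"
  have zero: "f (B ! j) = 0" if "length (B ! j) \<noteq> Suc k" for j
  proof -
    have "B ! j \<notin> ordered_simplices V E k"
      using that by (auto simp: ordered_simplices_def simplices_def distinct_card)
    then show ?thesis using f by (simp add: forms_def)
  qed
  have "(\<Sum>j<length B. ext_deriv V E (length (B ! j) - 1) (unit_form (B ! j)) (B ! i) * f (B ! j))
      = (\<Sum>j<length B. ext_deriv V E k (unit_form (B ! j)) (B ! i) * f (B ! j))"
    by (rule sum.cong) (use zero in \<open>force+\<close>)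
  also have "\<dots> = ext_deriv V E k f (B ! i)"
  proof (cases "B ! i \<in> ordered_simplices V E (Suc k)")
    case True
    have len: "length (B ! i) = Suc (Suc k)"
      using True by (auto simp: ordered_simplices_def simplices_def distinct_card)
    have del: "?del m \<in> ordered_simplices V E k" if "m \<le> Suc k" for m
    proof -
      have d: "distinct (?del m)"
        using True by (auto simp: ordered_simplices_def set_take_disj_set_drop_if_distinct)
      have s: "set (?del m) \<subseteq> set (B ! i)" by (auto dest: in_set_takeD in_set_dropD)
      have "length (?del m) = Suc k" using len that by auto
      then have "card (set (?del m)) = Suc k" using distinct_card[OF d] by simp
      then show ?thesis using True d s unfolding ordered_simplices_def simplices_def by blast
    qed
    have "ext_deriv V E k f (B ! i) =
        (\<Sum>m\<le>Suc k. (-1) ^ m * (\<Sum>j<length B. f (B ! j) * unit_form (B ! j) (?del m)))"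
      unfolding ext_deriv_def using True form_expansion[OF B f del]
      by (auto intro!: sum.cong simp del: sum.atMost_Suc)
    also have "\<dots> = (\<Sum>j<length B. ext_deriv V E k (unit_form (B ! j)) (B ! i) * f (B ! j))"
      unfolding ext_deriv_def
      by (simp only: True if_True sum_distrib_left sum_distrib_right mult_ac) (rule sum.swap)
    finally show ?thesis by simp
  qed (simp add: ext_deriv_def)
  finally show "(ext_deriv_mat V E B *\<^sub>v vec (length B) (\<lambda>j. f (B ! j))) $ i =
      vec (length B) (\<lambda>i. ext_deriv V E k f (B ! i)) $ i"
    using i by (simp add: ext_deriv_mat_def scalar_prod_def atLeast0LessThan)
qed (simp add: ext_deriv_mat_def)

end

theory Submission
  imports Defs "Jordan_Normal_Form.Jordan_Normal_Form_Uniqueness"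
begin

text \<open>Let \<open>\<gamma>\<close> be the diagonal sign operator \<open>(-1)\<^sup>k\<close> on \<open>\<Omega>\<^sub>k\<close>, so that the supertrace of \<open>A\<close> is
  the trace of \<open>\<gamma> A\<close>. The Dirac operator shifts degrees by one, hence anticommutes with \<open>\<gamma>\<close>.
  Diagonalise \<open>D = P \<Lambda> P\<^sup>-\<^sup>1\<close>, with columns \<open>u\<^sub>k\<close> of \<open>P\<close> and dual rows \<open>u\<^sub>k\<^sup>*\<close> of \<open>P\<^sup>-\<^sup>1\<close>.
  Evaluating \<open>u\<^sub>k\<^sup>* \<gamma> D u\<^sub>k = - u\<^sub>k\<^sup>* D \<gamma> u\<^sub>k\<close> gives \<open>2 \<lambda>\<^sub>k (u\<^sub>k\<^sup>* \<gamma> u\<^sub>k) = 0\<close>, so only the kernel of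
  \<open>D\<close> contributes to the supertrace of a function of \<open>D\<close>. Two functions of \<open>D\<close> that agree at 0
  therefore have equal supertraces; comparing \<open>exp (f(D))\<close> with the identity yields the
  Euler characteristic.\<close>

section \<open>Diagonalisation of real symmetric matrices\<close>

lemma symmetric_mult_scalar_prod:
  fixes A :: "'b :: comm_semiring_0 mat"
  assumes "A \<in> carrier_mat n n" "transpose_mat A = A" "x \<in> carrier_vec n" "y \<in> carrier_vec n"
  shows "(A *\<^sub>v x) \<bullet> y = x \<bullet> (A *\<^sub>v y)"
  using transpose_vec_mult_scalar[OF assms(1,4,3)] assms(2) by simp

lemma real_scalar_prod_self_eq_0:
  fixes v :: "real vec"
  assumes "v \<in> carrier_vec n" "v \<bullet> v = 0"
  shows "v = 0\<^sub>v n"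
proof -
  have "conjugate v = v" by (intro eq_vecI) auto
  then show ?thesis using conjugate_square_eq_0_vec[OF assms(1)] assms(2) by simp
qed

text \<open>If \<open>C * C\<close> kills \<open>v\<close>, symmetry gives
  \<open>(C v) \<bullet> (C v) = v \<bullet> (C (C v)) = 0\<close>, hence \<open>C v = 0\<close>.
  This is what rules out nontrivial Jordan blocks.\<close>

lemma symmetric_mat_kernel_square:
  fixes C :: "real mat"
  assumes C: "C \<in> carrier_mat n n" and sym: "transpose_mat C = C"
  shows "mat_kernel (C * C) = mat_kernel C"
proof
  show "mat_kernel C \<subseteq> mat_kernel (C * C)" by (rule mat_kernel_mult_subset[OF C C])
  show "mat_kernel (C * C) \<subseteq> mat_kernel C"
  proof
    fix v assume "v \<in> mat_kernel (C * C)"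
    then have v: "v \<in> carrier_vec n" and "C * C *\<^sub>v v = 0\<^sub>v n"
      using mat_kernelD[of "C * C" n n] C by auto
    then have "C *\<^sub>v (C *\<^sub>v v) = 0\<^sub>v n" using C by simp
    then have "(C *\<^sub>v v) \<bullet> (C *\<^sub>v v) = 0"
      using symmetric_mult_scalar_prod[OF C sym v, of "C *\<^sub>v v"] C v by simp
    then have "C *\<^sub>v v = 0\<^sub>v n" using C v by (intro real_scalar_prod_self_eq_0) auto
    then show "v \<in> mat_kernel C" using C v by (intro mat_kernelI)
  qed
qed

text \<open>Since the entries are real, \<open>conjugate v\<close> is an eigenvector for
  \<open>cnj \<mu>\<close>. Moving the matrix across the nonzero product
  \<open>v \<bullet>c v\<close> then identifies \<open>\<mu>\<close> with
  \<open>cnj \<mu>\<close>.\<close>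

lemma symmetric_complex_eigenvalue_real:
  fixes A :: "real mat"
  assumes A: "A \<in> carrier_mat n n" and sym: "transpose_mat A = A"
    and ev: "eigenvalue (map_mat complex_of_real A) \<mu>"
  shows "\<mu> \<in> \<real>"
proof -
  let ?A = "map_mat complex_of_real A"
  have cA: "?A \<in> carrier_mat n n" using A by simp
  have sA: "transpose_mat ?A = ?A"
    using sym by (metis map_mat_transpose)
  obtain v where v: "v \<in> carrier_vec n" "v \<noteq> 0\<^sub>v n" "?A *\<^sub>v v = \<mu> \<cdot>\<^sub>v v"
    using ev A by (auto simp: eigenvalue_def eigenvector_def)
  have "?A *\<^sub>v conjugate v = conjugate (?A *\<^sub>v v)"
  proof (rule eq_vecI)
    fix i assume "i < dim_vec (conjugate (?A *\<^sub>v v))"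
    then show "(?A *\<^sub>v conjugate v) $ i = conjugate (?A *\<^sub>v v) $ i"
      using A v(1) by (simp add: scalar_prod_def)
  qed simp
  then have cv: "?A *\<^sub>v conjugate v = cnj \<mu> \<cdot>\<^sub>v conjugate v"
    using v by (simp add: conjugate_smult_vec)
  have "(?A *\<^sub>v v) \<bullet> conjugate v = v \<bullet> (?A *\<^sub>v conjugate v)"
    using symmetric_mult_scalar_prod[OF cA sA v(1)] v(1) by simp
  then have "\<mu> * (v \<bullet>c v) = cnj \<mu> * (v \<bullet>c v)"
    using v cv by simp
  moreover have "v \<bullet>c v \<noteq> 0" using v by simp
  ultimately have "cnj \<mu> = \<mu>" by simp
  then show ?thesis by (simp add: Reals_cnj_iff)
qed

text \<open>Over the complex numbers the polynomial splits, and all its roots are real; the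
  factorisation descends because the embedding of coefficients is injective. Splitting is the
  condition for a Jordan normal form over the reals.\<close>

lemma symmetric_char_poly_splits:
  fixes A :: "real mat"
  assumes A: "A \<in> carrier_mat n n" and sym: "transpose_mat A = A"
  shows "\<exists>as. char_poly A = (\<Prod>a\<leftarrow>as. [:- a, 1:])"
proof -
  let ?A = "map_mat complex_of_real A"
  have cA: "?A \<in> carrier_mat n n" using A by simp
  interpret hom: map_poly_inj_comm_ring_hom complex_of_real ..
  obtain cs where cs: "char_poly ?A = (\<Prod>a\<leftarrow>cs. [:- a, 1:])"
    using char_poly_factorized[OF cA] by blast
  have "c \<in> \<real>" if "c \<in> set cs" for c
  proof (rule symmetric_complex_eigenvalue_real[OF A sym])
    show "eigenvalue ?A c"
      unfolding eigenvalue_root_char_poly[OF cA] cs poly_prod_list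
      using that by auto
  qed
  then have "map_poly complex_of_real (\<Prod>a\<leftarrow>map Re cs. [:- a, 1:]) = (\<Prod>a\<leftarrow>cs. [:- a, 1:])"
    by (induction cs) (simp_all add: hom.hom_mult del: mult_pCons_left)
  then have "map_poly complex_of_real (char_poly A)
      = map_poly complex_of_real (\<Prod>a\<leftarrow>map Re cs. [:- a, 1:])"
    using cs of_real_hom.char_poly_hom[OF A] by metis
  then have "char_poly A = (\<Prod>a\<leftarrow>map Re cs. [:- a, 1:])"
    by (rule hom.injectivity)
  then show ?thesis by blast
qed

section \<open>Jordan blocks of symmetric matrices\<close>

lemma sum_list_eq_pointwise:
  fixes f g :: "'b \<Rightarrow> nat"
  assumes "\<And>x. x \<in> set xs \<Longrightarrow> f x \<le> g x" "sum_list (map f xs) = sum_list (map g xs)"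
  shows "\<forall>x\<in>set xs. f x = g x"
  using assms
proof (induction xs)
  case (Cons a xs)
  have "sum_list (map f xs) \<le> sum_list (map g xs)"
    using Cons.prems by (intro sum_list_mono) auto
  moreover have "f a \<le> g a" using Cons.prems by simp
  ultimately have eq: "f a = g a" "sum_list (map f xs) = sum_list (map g xs)"
    using Cons.prems(2) by simp_all
  have "\<forall>x\<in>set xs. f x = g x" by (rule Cons.IH) (use Cons.prems(1) eq(2) in auto)
  then show ?case using eq(1) by auto
qed simp

lemma symmetric_jordan_nf_block_size:
  fixes A :: "real mat"
  assumes A: "A \<in> carrier_mat n n" and sym: "transpose_mat A = A"
    and jnf: "jordan_nf A n_as" and mem: "(m, a) \<in> set n_as"
  shows "m = 1"
proof -
  \<comment> \<open>A block of size at least 2 would make the kernel of \<open>(A - a)\<^sup>2\<close> larger than that of \<open>A - a\<close>.\<close>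
  let ?C = "char_matrix A a"
  have C: "?C \<in> carrier_mat n n" using A by simp
  have "transpose_mat ?C = ?C"
  proof (rule eq_matI)
    fix i j assume ij: "i < dim_row ?C" "j < dim_col ?C"
    then have "A $$ (i, j) = A $$ (j, i)"
      using sym A by (metis C carrier_matD index_transpose_mat(1))
    then show "transpose_mat ?C $$ (i, j) = ?C $$ (i, j)"
      using ij A by (auto simp: char_matrix_def)
  qed (use A in \<open>auto simp: char_matrix_def\<close>)
  from symmetric_mat_kernel_square[OF C this]
  have "kernel_dim (?C * ?C) = kernel_dim ?C"
    unfolding kernel_dim_def using C by simp
  then have "dim_gen_eigenspace A a 1 = dim_gen_eigenspace A a 2"
    using C by (simp add: dim_gen_eigenspace_def numeral_2_eq_2)
  \<comment> \<open>The kernel of the \<open>j\<close>-th power of \<open>A - a\<close> has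
    dimension the sum of \<open>min j k\<close> over the sizes \<open>k\<close> of the blocks for
    \<open>a\<close>. Equal sums for \<open>j = 1\<close> and \<open>j = 2\<close> force equality
    block by block.\<close>
  then have "\<forall>k\<in>set (map fst [(k, e)\<leftarrow>n_as. e = a]). min 1 k = min 2 k"
    unfolding dim_gen_eigenspace[OF jnf] by (intro sum_list_eq_pointwise) auto
  then have "min 1 m = min 2 m" using mem by force
  moreover have "m \<noteq> 0" using jnf mem by (force simp: jordan_nf_def)
  ultimately show ?thesis by linarith
qed

lemma jordan_matrix_size_one_blocks:
  assumes "\<forall>x\<in>set n_as. fst x = 1"
  shows "jordan_matrix n_as = mat_diag (length n_as) (\<lambda>i. snd (n_as ! i))"
  using assms
proof (induction n_as)
  case Nil
  show ?case by (intro eq_matI) (auto simp: mat_diag_def)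
next
  case (Cons x n_as)
  obtain a where x: "x = (1, a)" using Cons.prems by (cases x) auto
  have s: "sum_list (map fst n_as) = length n_as"
    using Cons.prems by (induction n_as) auto
  have IH: "jordan_matrix n_as = mat_diag (length n_as) (\<lambda>i. snd (n_as ! i))"
    using Cons by simp
  show ?case
    unfolding x jordan_matrix_Cons s IH
    by (intro eq_matI) (auto simp: mat_diag_def nth_Cons')
qed

text \<open>All Jordan blocks have size one, so the Jordan form is diagonal. Here \<open>Q\<close>
  is the inverse of \<open>P\<close>, not asserted to be its transpose; orthogonality is recovered
  later from the eigenspaces.\<close>

theorem symmetric_diagonalizable:
  fixes A :: "real mat"
  assumes A: "A \<in> carrier_mat n n" and sym: "transpose_mat A = A"
  obtains f P Q where "similar_mat_wit A (mat_diag n f) P Q"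
proof -
  obtain n_as where jnf: "jordan_nf A n_as"
    using symmetric_char_poly_splits[OF A sym] jordan_nf_exists[OF A] by blast
  have "jordan_matrix n_as = mat_diag (length n_as) (\<lambda>i. snd (n_as ! i))"
    using symmetric_jordan_nf_block_size[OF A sym jnf]
    by (intro jordan_matrix_size_one_blocks) auto
  then obtain P Q where PQ: "similar_mat_wit A (mat_diag (length n_as) (\<lambda>i. snd (n_as ! i))) P Q"
    using jnf by (auto simp: jordan_nf_def similar_mat_def)
  moreover have "length n_as = n"
    using similar_mat_witD2(5)[OF A PQ] by (auto simp: mat_diag_def)
  ultimately show thesis using that by blast
qed

section \<open>Functional calculus and exponential of a diagonalised matrix\<close>

lemma conjugated_diag_entry:
  fixes P Q :: "'b :: comm_semiring_1 mat"
  assumes "P \<in> carrier_mat n n" "Q \<in> carrier_mat n n" "i < n" "j < n"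
  shows "(P * mat_diag n h * Q) $$ (i, j) = (\<Sum>k<n. P $$ (i, k) * h k * Q $$ (k, j))"
  using assms
  by (simp add: mat_diag_mult_right[OF assms(1)] scalar_prod_def atLeast0LessThan)

lemma similar_mat_wit_of_real:
  assumes "similar_mat_wit A (mat_diag n f) P Q" "A \<in> carrier_mat n n"
  shows "similar_mat_wit (map_mat complex_of_real A) (mat_diag n (\<lambda>i. complex_of_real (f i)))
           (map_mat complex_of_real P) (map_mat complex_of_real Q)"
proof -
  note w = similar_mat_witD2[OF assms(2,1)]
  have d: "map_mat complex_of_real (mat_diag n f) = mat_diag n (\<lambda>i. complex_of_real (f i))"
    by (intro eq_matI) (auto simp: mat_diag_def)
  show ?thesis
  proof (rule similar_mat_witI)
    show "map_mat complex_of_real P * map_mat complex_of_real Q = 1\<^sub>m n"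
      using w by (metis of_real_hom.mat_hom_mult of_real_hom.mat_hom_one)
    show "map_mat complex_of_real Q * map_mat complex_of_real P = 1\<^sub>m n"
      using w by (metis of_real_hom.mat_hom_mult of_real_hom.mat_hom_one)
    have "map_mat complex_of_real (P * mat_diag n f * Q) = map_mat complex_of_real P
        * map_mat complex_of_real (mat_diag n f) * map_mat complex_of_real Q"
      using w by (metis of_real_hom.mat_hom_mult mult_carrier_mat)
    then show "map_mat complex_of_real A = map_mat complex_of_real P
        * mat_diag n (\<lambda>i. complex_of_real (f i)) * map_mat complex_of_real Q"
      using w(3) d by simp
  qed (use w in auto)
qed

text \<open>Both residuals \<open>x - P x\<close> and \<open>x - Q x\<close> are orthogonal to the
  eigenspace, which contains \<open>P x - Q x\<close>; so this difference is orthogonal to itself.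
  Uniqueness makes the definite description in \<open>spectral_proj\<close> meaningful.\<close>

lemma is_orth_proj_unique:
  assumes P: "is_orth_proj n (eigenspace A l) P" and Q: "is_orth_proj n (eigenspace A l) Q"
    and A: "A \<in> carrier_mat n n"
  shows "P = Q"
proof -
  have PQ: "P \<in> carrier_mat n n" "Q \<in> carrier_mat n n" using P Q by (auto simp: is_orth_proj_def)
  have eq: "P *\<^sub>v x = Q *\<^sub>v x" if x: "x \<in> carrier_vec n" for x
  proof -
    let ?p = "P *\<^sub>v x" and ?q = "Q *\<^sub>v x"
    have pq: "?p \<in> eigenspace A l" "?q \<in> eigenspace A l" using P Q x by (auto simp: is_orth_proj_def)
    then have c: "?p \<in> carrier_vec n" "?q \<in> carrier_vec n"
      using A by (auto simp: eigenspace_def)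
    have "A *\<^sub>v (?p - ?q) = l \<cdot>\<^sub>v (?p - ?q)"
    proof -
      have "A *\<^sub>v (?p - ?q) = l \<cdot>\<^sub>v ?p - l \<cdot>\<^sub>v ?q"
        using pq c A by (simp add: eigenspace_def mult_minus_distrib_mat_vec)
      also have "\<dots> = l \<cdot>\<^sub>v (?p - ?q)"
        using c carrier_vecD[OF c(1)] carrier_vecD[OF c(2)] by (intro eq_vecI)
          (simp_all add: right_diff_distrib del: index_mult_mat_vec dim_mult_mat_vec)
      finally show ?thesis .
    qed
    then have d: "?p - ?q \<in> eigenspace A l" using c A by (simp add: eigenspace_def)
    have "(x - ?p) \<bullet> (?p - ?q) = 0" "(x - ?q) \<bullet> (?p - ?q) = 0"
      using P Q d x by (auto simp: is_orth_proj_def)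
    moreover have "(?p - ?q) \<bullet> (?p - ?q) = (x - ?q) \<bullet> (?p - ?q) - (x - ?p) \<bullet> (?p - ?q)"
      using c x by (simp add: minus_scalar_prod_distrib[of _ n])
    ultimately have "?p - ?q = 0\<^sub>v n" using c by (intro real_scalar_prod_self_eq_0) auto
    then have "(?p - ?q) $ i = 0" if "i < n" for i using that by simp
    then show "?p = ?q" using PQ by (intro eq_vecI) auto
  qed
  show ?thesis
  proof (rule eq_matI)
    fix i j assume "i < dim_row Q" "j < dim_col Q"
    then show "P $$ (i, j) = Q $$ (i, j)"
      using arg_cong[OF eq[of "unit_vec n j"], of "\<lambda>v. v $ i"] PQ by simp
  qed (use PQ in auto)
qed

section \<open>Eigenspaces and spectral projections in the coordinates of a diagonalisation\<close>

lemma similar_mat_wit_intertwine: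
  assumes w: "similar_mat_wit A M P Q" and A: "A \<in> carrier_mat n n"
  shows "A * P = P * M" "Q * A = M * Q"
proof -
  note D = similar_mat_witD2[OF A w]
  have "A * P = P * M * (Q * P)"
    unfolding D(3) using D(5-7) by (intro assoc_mult_mat) auto
  then show "A * P = P * M" using D(2,5-7) by simp
  have "Q * A = Q * (P * (M * Q))"
    unfolding D(3) using D(5-7) by (simp add: assoc_mult_mat[of _ n n _ n _ n])
  also have "\<dots> = Q * P * (M * Q)"
    using D(5-7) by (intro assoc_mult_mat[symmetric]) auto
  finally show "Q * A = M * Q" using D(2,5-7) by simp
qed

lemma mat_diag_mult_vec:
  fixes y :: "'b :: semiring_1 vec"
  assumes "y \<in> carrier_vec n"
  shows "mat_diag n h *\<^sub>v y = vec n (\<lambda>k. h k * y $ k)"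
proof (rule eq_vecI)
  fix k assume "k < dim_vec (vec n (\<lambda>k. h k * y $ k))"
  then have k: "k < n" by simp
  have "(mat_diag n h *\<^sub>v y) $ k = (\<Sum>j\<in>{0..<n}. (if k = j then h j else 0) * y $ j)"
    using k assms unfolding mat_diag_def by (simp add: scalar_prod_def)
  also have "\<dots> = (\<Sum>j\<in>{0..<n}. if k = j then h j * y $ j else 0)"
    by (intro sum.cong) auto
  finally show "(mat_diag n h *\<^sub>v y) $ k = vec n (\<lambda>k. h k * y $ k) $ k"
    using k by simp
qed (simp add: mat_diag_def)

text \<open>Applying the invertible \<open>Q\<close> turns \<open>A x = l x\<close> into the
  coordinatewise equations \<open>f k * y k = l * y k\<close> for \<open>y = Q x\<close>.\<close>

lemma similar_diag_eigenspace_iff: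
  fixes A :: "real mat"
  assumes w: "similar_mat_wit A (mat_diag n f) P Q" and A: "A \<in> carrier_mat n n"
    and x: "x \<in> carrier_vec n"
  shows "x \<in> eigenspace A l \<longleftrightarrow> (\<forall>k<n. f k \<noteq> l \<longrightarrow> (Q *\<^sub>v x) $ k = 0)"
proof -
  note D = similar_mat_witD2[OF A w]
  have QA: "Q * A = mat_diag n f * Q"
    by (rule similar_mat_wit_intertwine(2)[OF w A])
  have "x \<in> eigenspace A l \<longleftrightarrow> A *\<^sub>v x = l \<cdot>\<^sub>v x" using x A by (simp add: eigenspace_def)
  also have "\<dots> \<longleftrightarrow> Q *\<^sub>v (A *\<^sub>v x) = Q *\<^sub>v (l \<cdot>\<^sub>v x)"
  proof
    assume "Q *\<^sub>v (A *\<^sub>v x) = Q *\<^sub>v (l \<cdot>\<^sub>v x)"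
    then have "P * Q *\<^sub>v (A *\<^sub>v x) = P * Q *\<^sub>v (l \<cdot>\<^sub>v x)"
      using D(6,7) A x by simp
    then show "A *\<^sub>v x = l \<cdot>\<^sub>v x" using D(1) A x by simp
  qed simp
  also have "\<dots> \<longleftrightarrow> mat_diag n f *\<^sub>v (Q *\<^sub>v x) = l \<cdot>\<^sub>v (Q *\<^sub>v x)"
    using assoc_mult_mat_vec[OF D(7) A x] assoc_mult_mat_vec[OF D(5,7) x] QA mult_mat_vec[OF D(7) x]
    by simp
  also have "\<dots> \<longleftrightarrow> (\<forall>k<n. f k * (Q *\<^sub>v x) $ k = l * (Q *\<^sub>v x) $ k)"
    using D(7) x by (auto simp: mat_diag_mult_vec[of _ n] vec_eq_iff)
  finally show ?thesis by auto
qed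

lemma symmetric_eigenspaces_orthogonal:
  fixes A :: "real mat"
  assumes A: "A \<in> carrier_mat n n" and sym: "transpose_mat A = A"
    and x: "x \<in> eigenspace A l" and y: "y \<in> eigenspace A m" and "l \<noteq> m"
  shows "x \<bullet> y = 0"
proof -
  have xy: "x \<in> carrier_vec n" "A *\<^sub>v x = l \<cdot>\<^sub>v x" "y \<in> carrier_vec n" "A *\<^sub>v y = m \<cdot>\<^sub>v y"
    using x y A by (auto simp: eigenspace_def)
  have "l * (x \<bullet> y) = m * (x \<bullet> y)"
    using symmetric_mult_scalar_prod[OF A sym xy(1,3)] xy by simp
  then show ?thesis using \<open>l \<noteq> m\<close> by simp
qed

lemma similar_diag_col_eigenspace:
  fixes A :: "real mat"
  assumes w: "similar_mat_wit A (mat_diag n f) P Q" and A: "A \<in> carrier_mat n n" and k: "k < n"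
  shows "col P k \<in> eigenspace A (f k)" "col P k \<noteq> 0\<^sub>v n"
proof -
  note D = similar_mat_witD2[OF A w]
  have c: "col P k \<in> carrier_vec n" using D by auto
  \<comment> \<open>This is column \<open>k\<close> of \<open>Q * P = 1\<close>.\<close>
  have q: "Q *\<^sub>v col P k = unit_vec n k"
    using col_mult2[OF D(7,6) k] D(2) k by simp
  then show "col P k \<in> eigenspace A (f k)"
    unfolding similar_diag_eigenspace_iff[OF w A c] using k by auto
  show "col P k \<noteq> 0\<^sub>v n"
  proof
    assume "col P k = 0\<^sub>v n"
    then have "(Q *\<^sub>v col P k) $ k = 0" using D(7) k by simp
    then show False using q k by simp
  qed
qed

text \<open>Guarantees that the sum over the spectrum in \<open>functional_calculus\<close> has a
  term for every diagonal entry.\<close>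

lemma similar_diag_spectrum:
  fixes A :: "real mat"
  assumes "similar_mat_wit A (mat_diag n f) P Q" "A \<in> carrier_mat n n" "k < n"
  shows "f k \<in> spectrum A"
  using similar_diag_col_eigenspace[OF assms] assms(2)
  by (auto simp: spectrum_def eigenvalue_def eigenvector_def eigenspace_def)

text \<open>The matrix on the right keeps exactly the coordinates with \<open>f k = l\<close>. The
  residual is then a combination of columns of \<open>P\<close> from other eigenspaces, which
  symmetry makes orthogonal to the eigenspace of \<open>l\<close>, although \<open>P\<close> itself
  need not be orthogonal.\<close>

lemma spectral_proj_similar_diag:
  assumes w: "similar_mat_wit A (mat_diag n f) P Q" and A: "A \<in> carrier_mat n n"
    and sym: "transpose_mat A = A"
  shows "spectral_proj A l = P * mat_diag n (\<lambda>k. if f k = l then 1 else 0) * Q"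
    (is "_ = ?R")
proof -
  note D = similar_mat_witD2[OF A w]
  have R: "?R \<in> carrier_mat n n" using D by (metis mat_diag_dim mult_carrier_mat)
  have Rx: "?R *\<^sub>v x = P *\<^sub>v vec n (\<lambda>k. if f k = l then (Q *\<^sub>v x) $ k else 0)"
    if "x \<in> carrier_vec n" for x
  proof -
    have "mat_diag n (\<lambda>k. if f k = l then 1 else 0) *\<^sub>v (Q *\<^sub>v x)
        = vec n (\<lambda>k. if f k = l then (Q *\<^sub>v x) $ k else 0)"
      using D(7) that by (auto simp: mat_diag_mult_vec[of _ n])
    moreover have "?R *\<^sub>v x = P *\<^sub>v (mat_diag n (\<lambda>k. if f k = l then 1 else 0) *\<^sub>v (Q *\<^sub>v x))"
      unfolding assoc_mult_mat_vec[OF mult_carrier_mat[OF D(6) mat_diag_dim] D(7) that]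
      by (rule assoc_mult_mat_vec[OF D(6) mat_diag_dim]) (use D(7) that in simp)
    ultimately show ?thesis by simp
  qed
  have "is_orth_proj n (eigenspace A l) ?R"
    unfolding is_orth_proj_def
  proof (intro conjI ballI R)
    fix x :: "real vec" assume x: "x \<in> carrier_vec n"
    let ?y = "vec n (\<lambda>k. if f k = l then (Q *\<^sub>v x) $ k else 0)"
    have Rxc: "?R *\<^sub>v x \<in> carrier_vec n" using R x by simp
    have QR: "Q *\<^sub>v (?R *\<^sub>v x) = ?y"
      unfolding Rx[OF x] using D(2,6,7) by (simp flip: assoc_mult_mat_vec[of _ n n _ n])
    show "?R *\<^sub>v x \<in> eigenspace A l"
      unfolding similar_diag_eigenspace_iff[OF w A Rxc] QR by auto
    fix v assume v: "v \<in> eigenspace A l"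
    then have vc: "v \<in> carrier_vec n" using A by (auto simp: eigenspace_def)
    let ?z = "x - ?R *\<^sub>v x"
    have zc: "?z \<in> carrier_vec n" using x R by auto
    have Qz: "(Q *\<^sub>v ?z) $ k = (if f k = l then 0 else (Q *\<^sub>v x) $ k)" if "k < n" for k
      using that D(7) x Rxc QR by (simp add: mult_minus_distrib_mat_vec[of _ n n])
    \<comment> \<open>Expands the residual in the columns of \<open>P\<close>, so that its product
      with \<open>v\<close> becomes a sum over columns.\<close>
    have z: "?z = P *\<^sub>v (Q *\<^sub>v ?z)"
      using D(1,6,7) zc by (simp flip: assoc_mult_mat_vec[of _ n n _ n])
    have Qzc: "Q *\<^sub>v ?z \<in> carrier_vec n" by (rule mult_mat_vec_carrier[OF D(7) zc])
    have Ptv: "transpose_mat P *\<^sub>v v \<in> carrier_vec n"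
      by (rule mult_mat_vec_carrier[OF _ vc]) (use D(6) in simp)
    have "?z \<bullet> v = v \<bullet> (P *\<^sub>v (Q *\<^sub>v ?z))"
      unfolding z[symmetric] by (rule comm_scalar_prod[OF zc vc])
    also have "\<dots> = (transpose_mat P *\<^sub>v v) \<bullet> (Q *\<^sub>v ?z)"
      by (rule transpose_vec_mult_scalar[OF D(6) Qzc vc, symmetric])
    also have "\<dots> = (Q *\<^sub>v ?z) \<bullet> (transpose_mat P *\<^sub>v v)"
      by (rule comm_scalar_prod[OF Ptv Qzc])
    also have "\<dots> = (\<Sum>k<n. (Q *\<^sub>v ?z) $ k * (col P k \<bullet> v))"
      using D(6) vc by (simp add: scalar_prod_def[of _ "transpose_mat P *\<^sub>v v"] atLeast0LessThan)
    also have "\<dots> = 0"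
    proof (rule sum.neutral, rule ballI)
      \<comment> \<open>If \<open>f k = l\<close> the coefficient vanishes by \<open>Qz\<close>;
        otherwise the column and \<open>v\<close> lie in different eigenspaces.\<close>
      fix k assume "k \<in> {..<n}"
      then show "(Q *\<^sub>v ?z) $ k * (col P k \<bullet> v) = 0"
        using Qz[of k] symmetric_eigenspaces_orthogonal[OF A sym
          similar_diag_col_eigenspace(1)[OF w A, of k] v] by auto
    qed
    finally show "?z \<bullet> v = 0" .
  qed
  then show ?thesis
    unfolding spectral_proj_def using A is_orth_proj_unique[OF _ _ A] by (intro the_equality) auto
qed

lemma functional_calculus_similar_diag:
  assumes w: "similar_mat_wit A (mat_diag n f) P Q" and A: "A \<in> carrier_mat n n"
    and sym: "transpose_mat A = A"
  shows "functional_calculus g A =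
    map_mat complex_of_real P * mat_diag n (\<lambda>k. g (f k)) * map_mat complex_of_real Q"
    (is "_ = ?P * _ * ?Q")
proof (rule eq_matI)
  note D = similar_mat_witD2[OF A w]
  fix i j assume "i < dim_row (?P * mat_diag n (\<lambda>k. g (f k)) * ?Q)"
    "j < dim_col (?P * mat_diag n (\<lambda>k. g (f k)) * ?Q)"
  then have ij: "i < n" "j < n" using D by auto
  have fin: "finite (spectrum A)" using card_finite_spectrum[OF A] by simp
  have "functional_calculus g A $$ (i, j) = (\<Sum>l\<in>spectrum A. g l * complex_of_real
      (\<Sum>k<n. P $$ (i, k) * (if f k = l then 1 else 0) * Q $$ (k, j)))"
    using ij A D(6,7)
    by (simp add: functional_calculus_def spectral_proj_similar_diag[OF w A sym]
        conjugated_diag_entry del: index_mult_mat)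
  also have "\<dots> = (\<Sum>l\<in>spectrum A. \<Sum>k<n. if f k = l
      then P $$ (i, k) * g (f k) * Q $$ (k, j) else 0)"
    by (simp add: sum_distrib_left) (intro sum.cong; simp)
  also have "\<dots> = (\<Sum>k<n. \<Sum>l\<in>spectrum A. if f k = l
      then P $$ (i, k) * g (f k) * Q $$ (k, j) else 0)"
    by (rule sum.swap)
  \<comment> \<open>The inner sum selects \<open>l = f k\<close>, which lies in the finite
    spectrum.\<close>
  also have "\<dots> = (\<Sum>k<n. P $$ (i, k) * g (f k) * Q $$ (k, j))"
    using fin similar_diag_spectrum[OF w A] by (intro sum.cong) auto
  also have "\<dots> = (?P * mat_diag n (\<lambda>k. g (f k)) * ?Q) $$ (i, j)"
    using ij D by (subst conjugated_diag_entry) auto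
  finally show "functional_calculus g A $$ (i, j)
      = (?P * mat_diag n (\<lambda>k. g (f k)) * ?Q) $$ (i, j)" .
qed (use A similar_mat_witD2[OF A w] in \<open>auto simp: functional_calculus_def\<close>)

section \<open>Powers and exponential of a diagonalised matrix\<close>

lemma mat_diag_pow: "mat_diag n h ^\<^sub>m m = mat_diag n (\<lambda>k. h k ^ m)"
proof (induction m)
  case 0
  show ?case by (simp add: carrier_matD[OF mat_diag_dim])
qed (simp add: power_Suc2 del: power_Suc)

text \<open>Conjugation commutes with powers, so each entry of the series is a finite combination of
  scalar exponential series and may be summed termwise.\<close>

lemma mat_exp_similar_diag:
  assumes w: "similar_mat_wit A (mat_diag n h) P Q" and A: "A \<in> carrier_mat n n"
  shows "mat_exp A = P * mat_diag n (\<lambda>k. exp (h k)) * Q"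
proof (rule eq_matI)
  note D = similar_mat_witD2[OF A w]
  fix i j assume "i < dim_row (P * mat_diag n (\<lambda>k. exp (h k)) * Q)"
    "j < dim_col (P * mat_diag n (\<lambda>k. exp (h k)) * Q)"
  then have ij: "i < n" "j < n" using D by auto
  have "(A ^\<^sub>m m) $$ (i, j) / fact m = (\<Sum>k<n. P $$ (i, k) * (h k ^ m /\<^sub>R fact m) * Q $$ (k, j))" for m
    using ij unfolding similar_mat_wit_pow_id[OF w] mat_diag_pow conjugated_diag_entry[OF D(6,7) ij]
    by (simp add: sum_divide_distrib scaleR_conv_of_real divide_simps)
  moreover have "(\<lambda>m. \<Sum>k<n. P $$ (i, k) * (h k ^ m /\<^sub>R fact m) * Q $$ (k, j))
      sums (\<Sum>k<n. P $$ (i, k) * exp (h k) * Q $$ (k, j))"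
    by (intro sums_sum sums_mult sums_mult2 exp_converges)
  ultimately have "(\<lambda>m. (A ^\<^sub>m m) $$ (i, j) / fact m)
      sums (\<Sum>k<n. P $$ (i, k) * exp (h k) * Q $$ (k, j))" by simp
  then show "mat_exp A $$ (i, j) = (P * mat_diag n (\<lambda>k. exp (h k)) * Q) $$ (i, j)"
    using ij A unfolding conjugated_diag_entry[OF D(6,7) ij] by (simp add: mat_exp_def sums_iff)
qed (use A similar_mat_witD2[OF A w] in \<open>auto simp: mat_exp_def\<close>)

section \<open>Supertraces\<close>

text \<open>Hypothesis \<open>odd\<close> is the anticommutation of \<open>D\<close> with the
  diagonal matrix of \<open>\<gamma>\<close>, read entry by entry. The right-hand side is the graded
  trace of the identity, the case where \<open>h\<close> is constantly 1.\<close>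

lemma graded_trace_odd_mat:
  fixes D :: "complex mat" and \<gamma> :: "nat \<Rightarrow> complex"
  assumes w: "similar_mat_wit D (mat_diag n f) P Q" and D: "D \<in> carrier_mat n n"
    and odd: "\<And>i j. i < n \<Longrightarrow> j < n \<Longrightarrow> D $$ (i, j) \<noteq> 0 \<Longrightarrow> \<gamma> i = - \<gamma> j"
    and h: "\<And>k. k < n \<Longrightarrow> f k = 0 \<Longrightarrow> h k = 1"
  shows "(\<Sum>i<n. \<gamma> i * (P * mat_diag n h * Q) $$ (i, i)) = (\<Sum>i<n. \<gamma> i)"
proof -
  note W = similar_mat_witD2[OF D w]
  \<comment> \<open>The \<open>k\<close>-th diagonal entry of \<open>Q \<gamma> P\<close>: the
    weight with which \<open>h k\<close> enters the graded trace.\<close>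
  define c where "c k = (\<Sum>i<n. Q $$ (k, i) * \<gamma> i * P $$ (i, k))" for k
  have tr: "(\<Sum>i<n. \<gamma> i * (P * mat_diag n g * Q) $$ (i, i)) = (\<Sum>k<n. g k * c k)" for g
  proof -
    have "(\<Sum>i<n. \<gamma> i * (P * mat_diag n g * Q) $$ (i, i))
        = (\<Sum>i<n. \<Sum>k<n. g k * (Q $$ (k, i) * \<gamma> i * P $$ (i, k)))"
      using W(6,7) by (intro sum.cong refl)
        (simp add: conjugated_diag_entry sum_distrib_left mult_ac del: index_mult_mat)
    also have "\<dots> = (\<Sum>k<n. g k * c k)"
      unfolding c_def sum_distrib_left by (rule sum.swap)
    finally show ?thesis .
  qed
  note DP = similar_mat_wit_intertwine(1)[OF w D] and QD = similar_mat_wit_intertwine(2)[OF w D]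
  have DP': "(\<Sum>j<n. D $$ (i, j) * P $$ (j, k)) = P $$ (i, k) * f k" if "i < n" "k < n" for i k
    using arg_cong[OF DP, of "\<lambda>M. M $$ (i, k)"] that W
    by (simp add: mat_diag_mult_right[of _ n] scalar_prod_def atLeast0LessThan)
  have QD': "(\<Sum>i<n. Q $$ (k, i) * D $$ (i, j)) = f k * Q $$ (k, j)" if "j < n" "k < n" for j k
    using arg_cong[OF QD, of "\<lambda>M. M $$ (k, j)"] that W
    by (simp add: mat_diag_mult_left[of _ n n] scalar_prod_def atLeast0LessThan)
  have c0: "c k = 0" if k: "k < n" "f k \<noteq> 0" for k
  proof -
    \<comment> \<open>The entry \<open>(k, k)\<close> of \<open>Q \<gamma> D P\<close> is computed
      twice: \<open>D\<close> acting on the column of \<open>P\<close> gives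
      \<open>f k * c k\<close>, while moving \<open>D\<close> past \<open>\<gamma>\<close> onto the
      row of \<open>Q\<close> gives the negative.\<close>
    have "f k * c k = (\<Sum>i<n. Q $$ (k, i) * \<gamma> i * (P $$ (i, k) * f k))"
      by (simp add: c_def sum_distrib_left mult_ac)
    also have "\<dots> = (\<Sum>i<n. \<Sum>j<n. Q $$ (k, i) * \<gamma> i * D $$ (i, j) * P $$ (j, k))"
      using k by (intro sum.cong refl, subst DP'[symmetric])
        (simp_all add: sum_distrib_left mult.assoc)
    also have "\<dots> = (\<Sum>i<n. \<Sum>j<n. - (Q $$ (k, i) * D $$ (i, j) * \<gamma> j * P $$ (j, k)))"
    proof (intro sum.cong refl)
      fix i j assume "i \<in> {..<n}" "j \<in> {..<n}"
      then show "Q $$ (k, i) * \<gamma> i * D $$ (i, j) * P $$ (j, k)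
          = - (Q $$ (k, i) * D $$ (i, j) * \<gamma> j * P $$ (j, k))"
        using odd[of i j] by (cases "D $$ (i, j) = 0") auto
    qed
    also have "\<dots> = - (\<Sum>j<n. (\<Sum>i<n. Q $$ (k, i) * D $$ (i, j)) * (\<gamma> j * P $$ (j, k)))"
      by (subst sum.swap) (simp add: sum_negf sum_distrib_right mult.assoc)
    also have "\<dots> = - (f k * c k)"
    proof -
      have "(\<Sum>j<n. (\<Sum>i<n. Q $$ (k, i) * D $$ (i, j)) * (\<gamma> j * P $$ (j, k)))
          = (\<Sum>j<n. f k * Q $$ (k, j) * (\<gamma> j * P $$ (j, k)))"
        using k by (intro sum.cong refl) (simp only: QD' lessThan_iff)
      then show ?thesis by (simp add: c_def sum_distrib_left mult.assoc)
    qed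
    finally show ?thesis using k by simp
  qed
  \<comment> \<open>Either \<open>c k = 0\<close>, or \<open>f k = 0\<close> and then
    \<open>h k = 1\<close>.\<close>
  have "(\<Sum>k<n. h k * c k) = (\<Sum>k<n. 1 * c k)"
    using c0 h by (intro sum.cong refl) (metis lessThan_iff mult_zero_right)
  also have "\<dots> = (\<Sum>i<n. \<gamma> i * (P * mat_diag n (\<lambda>_. 1) * Q) $$ (i, i))"
    by (rule tr[symmetric])
  also have "\<dots> = (\<Sum>i<n. \<gamma> i)" using W by simp
  finally show ?thesis unfolding tr .
qed

section \<open>Supertrace and Euler characteristic as sums over the enumeration\<close>

lemma oriented_enumeration_nth:
  assumes "oriented_enumeration V E B" "i < length B"
  obtains k where "B ! i \<in> ordered_simplices V E k" "length (B ! i) = Suc k"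
proof -
  have d: "distinct (B ! i)" using assms by (auto simp: oriented_enumeration_def)
  have "set (B ! i) \<in> set (map set B)" using assms by simp
  then obtain k where k: "set (B ! i) \<in> simplices V E k"
    using assms unfolding oriented_enumeration_def by blast
  then have "length (B ! i) = Suc k" using distinct_card[OF d] by (simp add: simplices_def)
  then show thesis using that k d by (simp add: ordered_simplices_def)
qed

text \<open>Shows that the cut-off \<open>k < card V\<close> in \<open>supertrace\<close> and
  \<open>euler_char\<close> loses no listed simplex.\<close>

lemma oriented_enumeration_length_le:
  assumes "finite V" "oriented_enumeration V E B" "i < length B"
  shows "length (B ! i) - 1 < card V"
proof -
  obtain k where k: "B ! i \<in> ordered_simplices V E k" "length (B ! i) = Suc k"
    using oriented_enumeration_nth[OF assms(2,3)] .
  then have "set (B ! i) \<subseteq> V" "card (set (B ! i)) = Suc k"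
    by (auto simp: ordered_simplices_def simplices_def)
  then have "Suc k \<le> card V" using card_mono[OF assms(1)] by metis
  then show ?thesis using k by simp
qed

lemma supertrace_eq_graded_trace:
  assumes V: "finite V" and B: "oriented_enumeration V E B"
    and A: "A \<in> carrier_mat (length B) (length B)"
  shows "supertrace V B A = (\<Sum>i<length B. (-1) ^ (length (B ! i) - 1) * A $$ (i, i))"
proof -
  let ?n = "length B"
  have g: "grade_proj B k = mat_diag ?n (\<lambda>i. if length (B ! i) = Suc k then 1 else 0)" for k
    by (intro eq_matI) (auto simp: grade_proj_def mat_diag_def)
  have "mat_trace (grade_proj B k * A * grade_proj B k)
      = (\<Sum>i<?n. if length (B ! i) - 1 = k then A $$ (i, i) else 0)" for k
  proof -
    \<comment> \<open>Truncated subtraction is harmless because a simplex has at least one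
      vertex.\<close>
    have "length (B ! i) = Suc k \<longleftrightarrow> length (B ! i) - 1 = k" if "i < ?n" for i
      using oriented_enumeration_nth[OF B that] by (metis diff_Suc_1)
    then show ?thesis
      unfolding g mat_diag_mult_left[OF A] using A
      by (subst mat_diag_mult_right[of _ ?n]) (auto simp: mat_trace_def intro!: sum.cong)
  qed
  then have "supertrace V B A = (\<Sum>k<card V. \<Sum>i<?n.
      if length (B ! i) - 1 = k then (-1) ^ (length (B ! i) - 1) * A $$ (i, i) else 0)"
    unfolding supertrace_def by (auto simp: sum_distrib_left intro!: sum.cong)
  also have "\<dots> = (\<Sum>i<?n. \<Sum>k<card V.
      if length (B ! i) - 1 = k then (-1) ^ (length (B ! i) - 1) * A $$ (i, i) else 0)"
    by (rule sum.swap)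
  also have "\<dots> = (\<Sum>i<?n. (-1) ^ (length (B ! i) - 1) * A $$ (i, i))"
    using oriented_enumeration_length_le[OF V B] by (intro sum.cong refl) simp
  finally show ?thesis .
qed

text \<open>Every simplex is listed exactly once, so counting simplices of dimension
  \<open>k\<close> is counting indices. The result is the graded trace of the identity
  matrix.\<close>

lemma euler_char_eq_sum_signs:
  assumes V: "finite V" and B: "oriented_enumeration V E B"
  shows "euler_char V E = (\<Sum>i<length B. (-1) ^ (length (B ! i) - 1))"
proof -
  let ?n = "length B"
  have "card (simplices V E k) = (\<Sum>i<?n. if length (B ! i) - 1 = k then 1 else 0)" for k
  proof -
    have inj: "inj_on (\<lambda>i. set (B ! i)) {..<?n}"
      using B by (auto simp: inj_on_def oriented_enumeration_def distinct_conv_nth)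
    have "simplices V E k = (\<lambda>i. set (B ! i)) ` {i. i < ?n \<and> length (B ! i) - 1 = k}" (is "_ = ?R")
    proof
      show "simplices V E k \<subseteq> ?R"
      proof
        fix s assume s: "s \<in> simplices V E k"
        then have "s \<in> set (map set B)" using B unfolding oriented_enumeration_def by blast
        then obtain i where i: "i < ?n" "s = set (B ! i)" by (auto simp: in_set_conv_nth)
        have "distinct (B ! i)" using B i by (auto simp: oriented_enumeration_def)
        then have "length (B ! i) = Suc k" using s i distinct_card by (force simp: simplices_def)
        then show "s \<in> ?R" using i by auto
      qed
      show "?R \<subseteq> simplices V E k"
      proof
        fix s assume "s \<in> ?R"
        then obtain i where i: "i < ?n" "length (B ! i) - 1 = k" "s = set (B ! i)" by auto
        obtain k' where "B ! i \<in> ordered_simplices V E k'" "length (B ! i) = Suc k'"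
          using oriented_enumeration_nth[OF B i(1)] .
        then show "s \<in> simplices V E k" using i by (simp add: ordered_simplices_def)
      qed
    qed
    then have "card (simplices V E k) = card {i. i < ?n \<and> length (B ! i) - 1 = k}"
      using inj by (metis (no_types, lifting) card_image inj_on_subset lessThan_iff mem_Collect_eq subsetI)
    also have "{i. i < ?n \<and> length (B ! i) - 1 = k} = {..<?n} \<inter> {i. length (B ! i) - 1 = k}"
      by auto
    finally show ?thesis by (simp add: sum.If_cases)
  qed
  then have "euler_char V E = (\<Sum>k<card V. \<Sum>i<?n.
      if length (B ! i) - 1 = k then (-1) ^ (length (B ! i) - 1) else 0)"
    unfolding euler_char_def by (auto simp: sum_distrib_left intro!: sum.cong)
  also have "\<dots> = (\<Sum>i<?n. \<Sum>k<card V.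
      if length (B ! i) - 1 = k then (-1) ^ (length (B ! i) - 1) else 0)"
    by (rule sum.swap)
  also have "\<dots> = (\<Sum>i<?n. (-1) ^ (length (B ! i) - 1))"
    using oriented_enumeration_length_le[OF V B] by (intro sum.cong refl) simp
  finally show ?thesis .
qed

lemma ext_deriv_mat_nonzero:
  assumes B: "oriented_enumeration V E B" and ij: "i < length B" "j < length B"
    and nz: "ext_deriv_mat V E B $$ (i, j) \<noteq> 0"
  shows "length (B ! i) = Suc (length (B ! j))"
proof -
  obtain k where k: "length (B ! j) = Suc k" using oriented_enumeration_nth[OF B ij(2)] .
  \<comment> \<open>Outside these lists \<open>ext_deriv\<close> takes its default value 0.\<close>
  have "B ! i \<in> ordered_simplices V E (Suc k)"
    using nz ij k by (auto simp: ext_deriv_mat_def ext_deriv_def split: if_splits)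
  then have "length (B ! i) = Suc (Suc k)"
    by (auto simp: ordered_simplices_def simplices_def distinct_card)
  then show ?thesis using k by simp
qed

text \<open>The exterior derivative raises the degree by one and its transpose lowers it by one;
  either way the parity flips.\<close>

lemma dirac_mat_odd:
  assumes B: "oriented_enumeration V E B" and ij: "i < length B" "j < length B"
    and nz: "dirac_mat V E B $$ (i, j) \<noteq> 0"
  shows "(-1) ^ (length (B ! i) - 1) = - ((-1) ^ (length (B ! j) - 1) :: complex)"
proof -
  obtain k l where kl: "length (B ! i) = Suc k" "length (B ! j) = Suc l"
    using oriented_enumeration_nth[OF B] ij by metis
  have "ext_deriv_mat V E B $$ (i, j) \<noteq> 0 \<or> ext_deriv_mat V E B $$ (j, i) \<noteq> 0"
    using nz ij by (auto simp: dirac_mat_def ext_deriv_mat_def)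
  then have "k = Suc l \<or> l = Suc k"
    using ext_deriv_mat_nonzero[OF B] ij kl by (metis Suc_inject)
  then show ?thesis using kl by auto
qed

lemma supertrace_conjugated_diag:
  assumes V: "finite V" and B: "oriented_enumeration V E B"
    and w: "similar_mat_wit (map_mat complex_of_real (dirac_mat V E B)) (mat_diag (length B) f) P Q"
    and h: "\<And>k. f k = 0 \<Longrightarrow> h k = 1"
  shows "supertrace V B (P * mat_diag (length B) h * Q) = of_int (euler_char V E)"
proof -
  let ?n = "length B" and ?D = "map_mat complex_of_real (dirac_mat V E B)"
  let ?\<gamma> = "\<lambda>i. (-1) ^ (length (B ! i) - 1) :: complex"
  have D: "?D \<in> carrier_mat ?n ?n" by (simp add: dirac_mat_def ext_deriv_mat_def)
  have M: "P * mat_diag ?n h * Q \<in> carrier_mat ?n ?n"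
    using similar_mat_witD2[OF D w] by (metis mat_diag_dim mult_carrier_mat)
  have "(\<Sum>i<?n. ?\<gamma> i * (P * mat_diag ?n h * Q) $$ (i, i)) = (\<Sum>i<?n. ?\<gamma> i)"
  proof (rule graded_trace_odd_mat[OF w D])
    show "?\<gamma> i = - ?\<gamma> j" if "i < ?n" "j < ?n" "?D $$ (i, j) \<noteq> 0" for i j
      using that D by (intro dirac_mat_odd[OF B]) auto
  qed (rule h)
  then show ?thesis
    unfolding supertrace_eq_graded_trace[OF V B M] euler_char_eq_sum_signs[OF V B] by simp
qed

section \<open>The McKean-Singer formula for functions of the Dirac operator\<close>

theorem mainTheorem1:
  fixes V :: "'a set" and E :: "'a set set" and B :: "'a list list"
  assumes "finite_simple_graph V E"
    and "oriented_enumeration V E B"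
  shows "(\<forall>f :: real \<Rightarrow> complex. continuous_on UNIV f \<and> f 0 = 0 \<longrightarrow>
            of_int (euler_char V E) =
              supertrace V B (mat_exp (functional_calculus f (dirac_mat V E B))))
       \<and> (\<forall>t :: complex.
            supertrace V B (mat_exp ((- t) \<cdot>\<^sub>m map_mat complex_of_real (laplace_mat V E B))) =
              of_int (euler_char V E))"
proof -
  let ?n = "length B" and ?D = "dirac_mat V E B"
  let ?Dc = "map_mat complex_of_real ?D"
  have V: "finite V" using assms(1) by (simp add: finite_simple_graph_def)
  note B = assms(2)
  have D: "?D \<in> carrier_mat ?n ?n" by (simp add: dirac_mat_def ext_deriv_mat_def)
  have Dc: "?Dc \<in> carrier_mat ?n ?n" using D by simp
  have sym: "transpose_mat ?D = ?D"
    by (intro eq_matI) (auto simp: dirac_mat_def ext_deriv_mat_def)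
  obtain \<mu> P Q where w: "similar_mat_wit ?D (mat_diag ?n \<mu>) P Q"
    using symmetric_diagonalizable[OF D sym] .
  let ?P = "map_mat complex_of_real P" and ?Q = "map_mat complex_of_real Q"
  note wc = similar_mat_wit_of_real[OF w D]
  note W = similar_mat_witD2[OF Dc wc]
  \<comment> \<open>Covers both claims: the exponential has diagonal values
    \<open>exp (h k)\<close>, which equal 1 wherever \<open>\<mu> k = 0\<close>.\<close>
  have str_exp: "supertrace V B (mat_exp A) = of_int (euler_char V E)"
    if A: "A = ?P * mat_diag ?n h * ?Q" and h: "\<And>k. \<mu> k = 0 \<Longrightarrow> h k = 0" for A h
  proof -
    have Ac: "A \<in> carrier_mat ?n ?n" unfolding A using W by (metis mat_diag_dim mult_carrier_mat)
    have "similar_mat_wit A (mat_diag ?n h) ?P ?Q"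
      using W A Ac by (intro similar_mat_witI) auto
    then show ?thesis
      by (subst mat_exp_similar_diag[OF _ Ac]) (auto intro!: supertrace_conjugated_diag[OF V B wc] simp: h)
  qed
  show ?thesis
  proof (intro conjI allI impI)
    fix f :: "real \<Rightarrow> complex" assume f: "continuous_on UNIV f \<and> f 0 = 0"
    show "of_int (euler_char V E) = supertrace V B (mat_exp (functional_calculus f ?D))"
      by (rule str_exp[OF functional_calculus_similar_diag[OF w D sym], symmetric]) (simp add: f)
  next
    fix t :: complex
    have "map_mat complex_of_real (laplace_mat V E B) = ?Dc ^\<^sub>m 2"
      using D Dc by (simp add: laplace_mat_def of_real_hom.mat_hom_mult[OF D D] numeral_2_eq_2)
    \<comment> \<open>The Laplacian is diagonalised by the same \<open>?P\<close> and
      \<open>?Q\<close>, so here \<open>h k\<close> is \<open>- t\<close> times the square of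
      \<open>\<mu> k\<close>.\<close>
    moreover have "similar_mat_wit ((- t) \<cdot>\<^sub>m ?Dc ^\<^sub>m 2)
        ((- t) \<cdot>\<^sub>m mat_diag ?n (\<lambda>k. complex_of_real (\<mu> k)) ^\<^sub>m 2) ?P ?Q"
      by (intro similar_mat_wit_smult similar_mat_wit_pow wc)
    moreover have "(- t) \<cdot>\<^sub>m mat_diag ?n (\<lambda>k. complex_of_real (\<mu> k)) ^\<^sub>m 2
        = mat_diag ?n (\<lambda>k. - t * complex_of_real (\<mu> k) ^ 2)"
      unfolding mat_diag_pow by (intro eq_matI) (auto simp: mat_diag_def)
    ultimately have "(- t) \<cdot>\<^sub>m map_mat complex_of_real (laplace_mat V E B)
        = ?P * mat_diag ?n (\<lambda>k. - t * complex_of_real (\<mu> k) ^ 2) * ?Q"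
      by (metis similar_mat_witD(3))
    then show "supertrace V B (mat_exp ((- t) \<cdot>\<^sub>m map_mat complex_of_real (laplace_mat V E B)))
        = of_int (euler_char V E)"
      by (rule str_exp) simp
  qed
qed

end
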